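(* For any pair $x,y\in\{0,1\}^n$ with Hamming distance $\Delta(x,y)\le 2k$, $\exp(O(k\log n))$ traces from the deletion channel with deletion probability $p\le 1-k/n$ suffice to distinguish, with high probability, whether the traces were generated from $x$ or from $y$.
   Context: The deletion channel with deletion probability $p$ takes a string in $\{0,1\}^n$ and deletes each coordinate independently with probability $p$, outputting the subsequence of surviving coordinates; each output is a trace. $\Delta(x,y)$ denotes the number of coordinates where $x$ and $y$ differ. "With high probability" means with probability at least $1-o(1)$ as $n\to\infty$. *)

theory Defs
  imports "HOL-Probability.Probability"
begin

definition hamming :: "'a list \<Rightarrow> 'a list \<Rightarrow> nat" where
  "hamming x y = card {i. i < length x \<and> x ! i \<noteq> y ! i}"

(* The random function tells which coordinates survive; nths keeps the entries at
   those positions, in order. *)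
definition deletion_channel :: "real \<Rightarrow> 'a list \<Rightarrow> 'a list pmf" where
  "deletion_channel p x =
     map_pmf (\<lambda>survives. nths x {i. survives i})
       (Pi_pmf {..<length x} False (\<lambda>_. bernoulli_pmf (1 - p)))"

definition traces :: "nat \<Rightarrow> real \<Rightarrow> 'a list \<Rightarrow> 'a list list pmf" where
  "traces m p x = replicate_pmf m (deletion_channel p x)"

(* Given m traces of an unknown source in {x, y}, the guess A names the source
   correctly except with probability at most e, whichever of the two it is. *)
definition distinguishes ::
  "('a list list \<Rightarrow> 'a list) \<Rightarrow> nat \<Rightarrow> real \<Rightarrow> real \<Rightarrow> 'a list \<Rightarrow> 'a list \<Rightarrow> bool" where
  "distinguishes A m p e x y \<longleftrightarrow>
     (\<forall>z\<in>{x, y}. measure_pmf.prob (traces m p z) {ts. A ts = z} \<ge> 1 - e)"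

end

theory Submission
  imports Defs
begin

text \<open>
  The statistic of a trace t is the sum, over its ones, of the binomial coefficient of their
  position over a. Every (a + 1)-set of coordinates ending in a one survives with probability
  (1 - p)^(a + 1), so the expected statistic is (1 - p)^(a + 1) times the statistic of the source.
  The functions i choose a with a < d span the polynomials of degree less than d, so by a
  Vandermonde argument some a < \<Delta>(x, y) \<le> 2k separates x and y. Their statistics are integers, so
  the expectations differ by at least (k/n)^(2k), while the statistic is at most n^(2k);
  Chebyshev's inequality for its empirical mean then needs only n^(O(k)) traces.
\<close>

section \<open>Binomial moments of a function with finite support\<close>

text \<open>Weighting each coefficient by \<open>i - j\<close> removes the point \<open>j\<close>
  and keeps the other coefficients nonzero. The weighted moment of order \<open>a\<close> is a
  linear combination of the original moments of orders \<open>a\<close> and \<open>Suc a\<close>, so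
  one of these two is nonzero.\<close>

lemma binomial_moments_nonzero:
  fixes c :: "nat \<Rightarrow> 'a :: {idom, ring_char_0}"
  assumes "finite D" "D \<noteq> {}" "\<And>i. i \<in> D \<Longrightarrow> c i \<noteq> 0"
  shows "\<exists>a<card D. (\<Sum>i\<in>D. c i * of_nat (i choose a)) \<noteq> 0"
  using assms
proof (induction D arbitrary: c rule: finite_ne_induct)
  case (singleton j)
  then show ?case by simp
next
  case (insert j D)
  let ?S = "\<lambda>a. \<Sum>i\<in>insert j D. c i * of_nat (i choose a)"
  have "\<exists>a<card D. (\<Sum>i\<in>D. (c i * (of_nat i - of_nat j)) * of_nat (i choose a)) \<noteq> 0"
    using insert.hyps insert.prems by (intro insert.IH) auto
  then obtain a where a: "a < card D"
    "(\<Sum>i\<in>D. (c i * (of_nat i - of_nat j)) * of_nat (i choose a)) \<noteq> 0"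
    by blast
  \<comment> \<open>Splitting \<open>i\<close> as \<open>(i - a) + a\<close> expresses
    multiplication by \<open>i\<close> in the binomial basis; absorption rewrites the first
    part.\<close>
  have step: "of_nat i * of_nat (i choose a) =
      (of_nat (Suc a) * of_nat (i choose Suc a) + of_nat a * of_nat (i choose a) :: 'a)" for i
  proof -
    have "i * (i choose a) = Suc a * (i choose Suc a) + a * (i choose a)"
    proof (cases "a \<le> i")
      case True
      then have "i * (i choose a) = (i - a) * (i choose a) + a * (i choose a)"
        by (simp flip: add_mult_distrib)
      then show ?thesis
        by (simp only: binomial_absorb_comp binomial_absorption)
    qed (simp add: binomial_eq_0)
    then show ?thesis
      by (metis of_nat_add of_nat_mult)
  qed
  \<comment> \<open>The point \<open>j\<close> can be added back because its weight is zero.\<close>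
  have "(\<Sum>i\<in>D. (c i * (of_nat i - of_nat j)) * of_nat (i choose a)) =
      (\<Sum>i\<in>insert j D. (c i * (of_nat i - of_nat j)) * of_nat (i choose a))"
    using insert.hyps by simp
  also have "\<dots> = (\<Sum>i\<in>insert j D. of_nat (Suc a) * (c i * of_nat (i choose Suc a)) +
      (of_nat a - of_nat j) * (c i * of_nat (i choose a)))"
  proof (rule sum.cong)
    fix i
    have "(c i * (of_nat i - of_nat j)) * of_nat (i choose a) =
        c i * (of_nat i * of_nat (i choose a)) - of_nat j * (c i * of_nat (i choose a))"
      by (simp add: algebra_simps)
    then show "(c i * (of_nat i - of_nat j)) * of_nat (i choose a) =
        of_nat (Suc a) * (c i * of_nat (i choose Suc a)) +
        (of_nat a - of_nat j) * (c i * of_nat (i choose a))"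
      unfolding step by (simp add: algebra_simps)
  qed simp
  also have "\<dots> = of_nat (Suc a) * ?S (Suc a) + (of_nat a - of_nat j) * ?S a"
    unfolding sum.distrib sum_distrib_left ..
  finally have "?S (Suc a) \<noteq> 0 \<or> ?S a \<noteq> 0"
    using a(2) by auto
  moreover have "Suc a < card (insert j D)" "a < card (insert j D)"
    using a(1) insert.hyps by auto
  ultimately show ?case by blast
qed

section \<open>The statistic of a string\<close>

text \<open>Positions start at 0, so \<open>i choose a\<close> counts the \<open>a\<close>-sets of
  positions before \<open>i\<close>. The total is thus the number of \<open>Suc a\<close>-sets of
  positions whose last entry is a one.\<close>

definition ones_moment :: "nat \<Rightarrow> bool list \<Rightarrow> nat" where
  "ones_moment a t = (\<Sum>i<length t. if t ! i then i choose a else 0)"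

lemma ones_moment_Nil [simp]: "ones_moment a [] = 0"
  by (simp add: ones_moment_def)

lemma ones_moment_snoc:
  "ones_moment a (t @ [c]) = ones_moment a t + (if c then length t choose a else 0)"
  by (auto simp: ones_moment_def nth_append)

lemma ones_moment_le: "ones_moment a t \<le> length t ^ Suc a"
proof -
  have "i choose a \<le> length t ^ a" if "i < length t" for i
  proof (cases "a \<le> i")
    case True
    then have "i choose a \<le> i ^ a" by (rule binomial_le_pow)
    also have "\<dots> \<le> length t ^ a" using that by (simp add: power_mono)
    finally show ?thesis .
  qed (simp add: binomial_eq_0)
  then have "ones_moment a t \<le> (\<Sum>i<length t. length t ^ a)"
    unfolding ones_moment_def by (intro sum_mono) auto
  then show ?thesis by simp
qed

text \<open>The difference of the two statistics is a binomial moment of the differences of the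
  bits, which are nonzero exactly on the \<open>hamming x y\<close> positions of
  disagreement.\<close>

lemma ones_moment_separates:
  assumes "length x = length y" "x \<noteq> y"
  obtains a where "a < hamming x y" "ones_moment a x \<noteq> ones_moment a y"
proof -
  define D where "D = {i. i < length x \<and> x ! i \<noteq> y ! i}"
  define c :: "nat \<Rightarrow> int" where "c i = of_bool (x ! i) - of_bool (y ! i)" for i
  have D: "finite D" "D \<noteq> {}" "\<And>i. i \<in> D \<Longrightarrow> c i \<noteq> 0"
    using assms by (auto simp: D_def c_def list_eq_iff_nth_eq)
  from binomial_moments_nonzero[of D c, OF this] obtain a
    where a: "a < card D" "(\<Sum>i\<in>D. c i * of_nat (i choose a)) \<noteq> 0"
    by blast
  have "(\<Sum>i\<in>D. c i * of_nat (i choose a)) = (\<Sum>i<length x. c i * of_nat (i choose a))"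
    by (rule sum.mono_neutral_left) (auto simp: D_def c_def)
  also have "\<dots> = int (ones_moment a x) - int (ones_moment a y)"
    unfolding ones_moment_def of_nat_sum using assms(1)
    by (auto simp: c_def simp flip: sum_subtractf intro!: sum.cong)
  finally show thesis
    using a that[of a] by (auto simp: D_def hamming_def)
qed

section \<open>The deletion channel and expectations under it\<close>

lemma deletion_channel_Nil [simp]: "deletion_channel p [] = return_pmf []"
  by (simp add: deletion_channel_def)

text \<open>Splitting off the last coordinate, rather than the first, shifts no index of survival,
  and a surviving last bit lands at position \<open>length t\<close>, as
  \<open>ones_moment_snoc\<close> expects.\<close>

lemma deletion_channel_snoc:
  "deletion_channel p (x @ [c]) =
     bernoulli_pmf (1 - p) \<bind>
       (\<lambda>b. map_pmf (\<lambda>t. if b then t @ [c] else t) (deletion_channel p x))"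
proof -
  have upd: "nths (x @ [c]) {i. (f(length x := b)) i} =
      (if b then nths x {i. f i} @ [c] else nths x {i. f i})" for f b
  proof -
    have "nths x {i. (f(length x := b)) i} = nths x {i. f i}"
      unfolding nths_def by (rule arg_cong[where f = "map fst"], rule filter_cong)
        (auto simp: set_zip)
    then show ?thesis by (simp add: nths_append nths_singleton)
  qed
  show ?thesis
    unfolding deletion_channel_def
    by (simp add: lessThan_Suc Pi_pmf_insert' map_bind_pmf map_pmf_comp upd
          flip: map_pmf_def)
qed

lemma finite_set_deletion_channel [simp]: "finite (set_pmf (deletion_channel p x))"
  by (induction x rule: rev_induct) (simp_all add: deletion_channel_snoc)

lemma length_deletion_channel:
  "t \<in> set_pmf (deletion_channel p x) \<Longrightarrow> length t \<le> length x"
proof (induction x arbitrary: t rule: rev_induct)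
  case (snoc c x)
  then show ?case by (force simp: deletion_channel_snoc split: if_splits dest: snoc.IH)
qed simp

lemma expectation_deletion_channel_snoc:
  fixes h :: "'a list \<Rightarrow> real"
  assumes "0 \<le> p" "p \<le> 1"
  shows "measure_pmf.expectation (deletion_channel p (x @ [c])) h =
    (1 - p) * measure_pmf.expectation (deletion_channel p x) (\<lambda>t. h (t @ [c])) +
    p * measure_pmf.expectation (deletion_channel p x) h"
  unfolding deletion_channel_snoc using assms
  by (subst pmf_expectation_bind[where A = UNIV]) (auto simp: UNIV_bool)

text \<open>Each \<open>a\<close>-set of coordinates survives with probability
  \<open>(1 - p) ^ a\<close>. The induction sees this through Pascal's rule, which is why
  \<open>a\<close> varies in it.\<close>

lemma expectation_length_choose:
  assumes "0 \<le> p" "p \<le> 1"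
  shows "measure_pmf.expectation (deletion_channel p x) (\<lambda>t. real (length t choose a)) =
    (1 - p) ^ a * real (length x choose a)"
proof (induction x arbitrary: a rule: rev_induct)
  case Nil
  then show ?case by (cases a) auto
next
  case (snoc c x)
  note int = integrable_measure_pmf_finite[OF finite_set_deletion_channel]
  show ?case
  proof (cases a)
    case (Suc b)
    then show ?thesis
      by (simp add: expectation_deletion_channel_snoc assms snoc.IH int
          Bochner_Integration.integral_add algebra_simps)
  qed simp
qed

text \<open>A final one adds \<open>length t choose a\<close> if it survives; its own survival
  supplies the additional factor \<open>1 - p\<close>.\<close>

lemma expectation_ones_moment:
  assumes "0 \<le> p" "p \<le> 1"
  shows "measure_pmf.expectation (deletion_channel p x) (\<lambda>t. real (ones_moment a t)) =
    (1 - p) ^ Suc a * real (ones_moment a x)"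
proof (induction x rule: rev_induct)
  case (snoc c x)
  note int = integrable_measure_pmf_finite[OF finite_set_deletion_channel]
  show ?case
    by (cases c) (simp_all add: expectation_deletion_channel_snoc assms snoc.IH int
        ones_moment_snoc expectation_length_choose algebra_simps)
qed simp

section \<open>Sums over independent samples\<close>

lemma finite_set_replicate_pmf:
  assumes "finite (set_pmf M)"
  shows "finite (set_pmf (replicate_pmf m M))"
  using assms by (induction m) auto

lemma expectation_replicate_pmf_Suc:
  fixes h :: "'a list \<Rightarrow> real"
  assumes "finite (set_pmf M)"
  shows "measure_pmf.expectation (replicate_pmf (Suc m) M) h =
    measure_pmf.expectation M (\<lambda>t. measure_pmf.expectation (replicate_pmf m M) (\<lambda>ts. h (t # ts)))"
proof -
  have "measure_pmf.expectation (replicate_pmf (Suc m) M) h =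
      (\<Sum>t\<in>set_pmf M. pmf M t *\<^sub>R
        measure_pmf.expectation (replicate_pmf m M) (\<lambda>ts. h (t # ts)))"
    using assms unfolding replicate_pmf.simps
    by (subst pmf_expectation_bind[where A = "set_pmf M"])
      (auto simp: finite_set_replicate_pmf simp flip: map_pmf_def)
  also have "\<dots> =
      measure_pmf.expectation M (\<lambda>t. measure_pmf.expectation (replicate_pmf m M) (\<lambda>ts. h (t # ts)))"
    using assms by (intro integral_measure_pmf[symmetric]) auto
  finally show ?thesis .
qed

lemma expectation_sum_list_replicate_pmf:
  fixes h :: "'a \<Rightarrow> real"
  assumes "finite (set_pmf M)"
  shows "measure_pmf.expectation (replicate_pmf m M) (\<lambda>ts. \<Sum>t\<leftarrow>ts. h t) =
    real m * measure_pmf.expectation M h"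
proof (induction m)
  case (Suc m)
  note int = integrable_measure_pmf_finite[OF finite_set_replicate_pmf[OF assms]]
    integrable_measure_pmf_finite[OF assms]
  show ?case
    by (simp add: expectation_replicate_pmf_Suc assms int Suc.IH algebra_simps
        del: replicate_pmf.simps(2))
qed simp

text \<open>When the square is expanded, the cross terms vanish by independence and
  centering.\<close>

lemma expectation_sum_list_squared_replicate_pmf:
  fixes h :: "'a \<Rightarrow> real"
  assumes "finite (set_pmf M)" "measure_pmf.expectation M h = 0"
  shows "measure_pmf.expectation (replicate_pmf m M) (\<lambda>ts. (\<Sum>t\<leftarrow>ts. h t)\<^sup>2) =
    real m * measure_pmf.expectation M (\<lambda>t. (h t)\<^sup>2)"
proof (induction m)
  case (Suc m)
  note int = integrable_measure_pmf_finite[OF finite_set_replicate_pmf[OF assms(1)]]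
    integrable_measure_pmf_finite[OF assms(1)]
  show ?case
    by (simp add: expectation_replicate_pmf_Suc assms int Suc.IH power2_sum algebra_simps
        expectation_sum_list_replicate_pmf del: replicate_pmf.simps(2))
qed simp

lemma replicate_pmf_Chebyshev:
  fixes g :: "'a \<Rightarrow> real"
  assumes fin: "finite (set_pmf M)"
    and bound: "\<And>t. t \<in> set_pmf M \<Longrightarrow> 0 \<le> g t \<and> g t \<le> B"
    and pos: "\<delta> > 0" "m > 0"
  shows "measure_pmf.prob (replicate_pmf m M)
      {ts. \<delta> \<le> \<bar>(\<Sum>t\<leftarrow>ts. g t) / real m - measure_pmf.expectation M g\<bar>} \<le> B\<^sup>2 / (real m * \<delta>\<^sup>2)"
proof -
  let ?R = "replicate_pmf m M"
  define \<mu> where "\<mu> = measure_pmf.expectation M g"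
  define h where "h t = g t - \<mu>" for t
  note int = integrable_measure_pmf_finite[OF finite_set_replicate_pmf[OF fin]]
    integrable_measure_pmf_finite[OF fin]
  have h0: "measure_pmf.expectation M h = 0"
    unfolding h_def by (simp add: int \<mu>_def)
  have "measure_pmf.expectation M (\<lambda>t. (h t)\<^sup>2) = measure_pmf.variance M g"
    by (simp add: h_def \<mu>_def)
  also have "\<dots> \<le> measure_pmf.expectation M (\<lambda>t. (g t)\<^sup>2)"
    by (subst measure_pmf.variance_eq) (simp_all add: int)
  also have "\<dots> \<le> measure_pmf.expectation M (\<lambda>t. B\<^sup>2)"
    by (rule integral_mono_AE) (auto simp: int AE_measure_pmf_iff bound intro!: power_mono)
  finally have var: "measure_pmf.expectation M (\<lambda>t. (h t)\<^sup>2) \<le> B\<^sup>2"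
    by simp
  have sum_h: "(\<Sum>t\<leftarrow>ts. h t) = (\<Sum>t\<leftarrow>ts. g t) - real (length ts) * \<mu>" for ts
    by (induction ts) (auto simp: h_def algebra_simps)
  have mean: "(\<Sum>t\<leftarrow>ts. h t) = (\<Sum>t\<leftarrow>ts. g t) - real m * \<mu>"
    if "ts \<in> set_pmf ?R" for ts
    using that by (simp add: sum_h set_replicate_pmf)
  \<comment> \<open>The two events agree only almost surely, since \<open>mean\<close> relies on
    \<open>ts\<close> having length \<open>m\<close>.\<close>
  have "measure_pmf.prob ?R {ts. \<delta> \<le> \<bar>(\<Sum>t\<leftarrow>ts. g t) / real m - \<mu>\<bar>} =
      measure_pmf.prob ?R {ts. real m * \<delta> \<le> \<bar>\<Sum>t\<leftarrow>ts. h t\<bar>}"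
    using pos by (intro measure_pmf.finite_measure_eq_AE)
      (auto simp: AE_measure_pmf_iff mean field_simps)
  also have "\<dots> \<le> measure_pmf.expectation ?R (\<lambda>ts. (\<Sum>t\<leftarrow>ts. h t)\<^sup>2) / (real m * \<delta>)\<^sup>2"
    using measure_pmf.second_moment_method[of "\<lambda>ts. \<Sum>t\<leftarrow>ts. h t" ?R "real m * \<delta>"] pos
    by (simp add: int)
  also have "\<dots> \<le> (real m * B\<^sup>2) / (real m * \<delta>)\<^sup>2"
    unfolding expectation_sum_list_squared_replicate_pmf[OF fin h0]
    by (intro divide_right_mono mult_left_mono var) auto
  also have "\<dots> = B\<^sup>2 / (real m * \<delta>\<^sup>2)"
    using pos by (simp add: power2_eq_square)
  finally show ?thesis unfolding \<mu>_def .
qed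

section \<open>Testing by an empirical mean\<close>

text \<open>The guess is \<open>x\<close> when the empirical mean lies within
  \<open>\<delta> / 2\<close> of \<open>\<mu> x\<close>, and \<open>y\<close> otherwise. By the gap,
  a wrong guess puts it at least \<open>\<delta> / 2\<close> away from the true mean; halving
  \<open>\<delta>\<close> produces the factor 4.\<close>

lemma distinguishes_by_statistic:
  fixes g :: "'a list \<Rightarrow> real" and p :: real
  defines "\<mu> \<equiv> \<lambda>z. measure_pmf.expectation (deletion_channel p z) g"
  assumes bound: "\<And>z t. z \<in> {x, y} \<Longrightarrow> t \<in> set_pmf (deletion_channel p z) \<Longrightarrow> 0 \<le> g t \<and> g t \<le> B"
    and gap: "0 < \<delta>" "\<delta> \<le> \<bar>\<mu> x - \<mu> y\<bar>"
    and m: "m > 0" "4 * B\<^sup>2 / (real m * \<delta>\<^sup>2) \<le> e"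
  shows "\<exists>A. distinguishes A m p e x y"
proof -
  define mean where "mean ts = (\<Sum>t\<leftarrow>ts. g t) / real m" for ts
  define A where "A ts = (if \<bar>mean ts - \<mu> x\<bar> < \<delta> / 2 then x else y)" for ts
  have "1 - e \<le> measure_pmf.prob (traces m p z) {ts. A ts = z}" if z: "z \<in> {x, y}" for z
  proof -
    let ?R = "traces m p z"
    have "- {ts. A ts = z} \<subseteq> {ts. \<delta> / 2 \<le> \<bar>mean ts - \<mu> z\<bar>}"
      using z gap by (auto simp: A_def abs_if split: if_splits)
    then have "measure_pmf.prob ?R (- {ts. A ts = z}) \<le>
        measure_pmf.prob ?R {ts. \<delta> / 2 \<le> \<bar>mean ts - \<mu> z\<bar>}"
      by (intro measure_pmf.finite_measure_mono) auto
    also have "\<dots> \<le> B\<^sup>2 / (real m * (\<delta> / 2)\<^sup>2)"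
      unfolding mean_def \<mu>_def traces_def
      using gap m bound[OF z] by (intro replicate_pmf_Chebyshev) auto
    also have "\<dots> = 4 * B\<^sup>2 / (real m * \<delta>\<^sup>2)"
      by (simp add: power_divide)
    also note m(2)
    finally show ?thesis
      using measure_pmf.prob_compl[of "{ts. A ts = z}" ?R] by (simp add: Compl_eq_Diff_UNIV)
  qed
  then show ?thesis by (auto simp: distinguishes_def)
qed

theorem theorem3:
  shows "\<exists>C > 0. \<exists>\<epsilon> :: nat \<Rightarrow> real. \<epsilon> \<longlonglongrightarrow> 0 \<and>
    (\<forall>(n::nat) (k::nat) (p::real) (x::bool list) (y::bool list) (m::nat).
       length x = n \<longrightarrow> length y = n \<longrightarrow> x \<noteq> y \<longrightarrow> hamming x y \<le> 2 * k \<longrightarrow>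
       0 \<le> p \<longrightarrow> p \<le> 1 - real k / real n \<longrightarrow>
       real m \<ge> exp (C * real k * ln (real n)) \<longrightarrow>
       (\<exists>A. distinguishes A m p (\<epsilon> n) x y))"
\<comment> \<open>With \<open>N = n ^ k\<close>, statistics at most \<open>N ^ 2\<close> and a gap
  of at least \<open>1 / N ^ 2\<close> give the error bound \<open>4 * N ^ 8 / m\<close>. The ninth
  power of \<open>N\<close> in \<open>m\<close> leaves \<open>4 / N\<close>, which is at most
  \<open>4 / n\<close>.\<close>
proof (intro exI[of _ "9::real"] exI[of _ "\<lambda>n. 4 / real n"] conjI allI impI)
  show "(\<lambda>n. 4 / real n) \<longlonglongrightarrow> 0"
    by (rule lim_const_over_n)
next
  fix n k :: nat and p :: real and x y :: "bool list" and m :: nat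
  assume len: "length x = n" "length y = n" and "x \<noteq> y"
    and ham: "hamming x y \<le> 2 * k"
    and p: "0 \<le> p" "p \<le> 1 - real k / real n"
    and m: "exp (9 * real k * ln (real n)) \<le> real m"
  obtain a where a: "a < hamming x y" "ones_moment a x \<noteq> ones_moment a y"
    using ones_moment_separates[of x y] len \<open>x \<noteq> y\<close> by auto
  have n: "n \<ge> 1"
    using len \<open>x \<noteq> y\<close> by (cases n) auto
  have ak: "Suc a \<le> 2 * k" and k: "k \<ge> 1"
    using a(1) ham by auto
  define N where "N = real n ^ k"
  have N: "N \<ge> 1" "real n \<le> N"
    using n k by (auto simp: N_def self_le_power)
  have m_ge: "N ^ 9 \<le> real m"
  proof -
    have "exp (9 * real k * ln (real n)) = exp (real (k * 9) * ln (real n))"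
      by (simp add: mult.commute)
    also have "\<dots> = real n ^ (k * 9)"
      using n by (subst exp_of_nat_mult) simp
    finally show ?thesis using m by (simp add: N_def power_mult)
  qed
  have m_pos: "m > 0"
    using m exp_gt_zero[of "9 * real k * ln (real n)"] by linarith
  \<comment> \<open>Weakening \<open>k / n\<close> to \<open>1 / n\<close> makes the lower bound on
    the gap a pure power of \<open>n\<close>.\<close>
  have q: "1 / real n \<le> 1 - p" "p \<le> 1"
  proof -
    have "1 / real n \<le> real k / real n"
      using k by (intro divide_right_mono) auto
    then show "1 / real n \<le> 1 - p" using p by linarith
    then show "p \<le> 1" using n by (smt (verit) divide_nonneg_nonneg of_nat_0_le_iff)
  qed
  define \<mu> where "\<mu> z = measure_pmf.expectation (deletion_channel p z)
    (\<lambda>t. real (ones_moment a t))" for z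
  have "1 / N\<^sup>2 = (1 / real n) ^ (2 * k)"
    by (simp add: N_def power_one_over flip: power_mult) (simp add: mult.commute)
  also have "\<dots> \<le> (1 / real n) ^ Suc a"
    using n ak by (intro power_decreasing) auto
  also have "\<dots> \<le> (1 - p) ^ Suc a"
    using q by (intro power_mono) auto
  also have "\<dots> \<le> (1 - p) ^ Suc a * \<bar>real (ones_moment a x) - real (ones_moment a y)\<bar>"
  proof -
    \<comment> \<open>Distinct natural numbers differ by at least 1.\<close>
    have "1 \<le> \<bar>real (ones_moment a x) - real (ones_moment a y)\<bar>"
      using a(2) by linarith
    then show ?thesis
      using mult_left_mono[of 1 _ "(1 - p) ^ Suc a"] q by simp
  qed
  also have "\<dots> = \<bar>\<mu> x - \<mu> y\<bar>"
    using p(1) q(2) unfolding \<mu>_def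
    by (simp add: expectation_ones_moment abs_mult flip: right_diff_distrib del: power_Suc)
  finally have gap: "1 / N\<^sup>2 \<le> \<bar>\<mu> x - \<mu> y\<bar>" .
  have bound: "real (ones_moment a t) \<le> N\<^sup>2"
    if "z \<in> {x, y}" "t \<in> set_pmf (deletion_channel p z)" for z t
  proof -
    have "length t \<le> n"
      using length_deletion_channel[OF that(2)] that(1) len by auto
    then have "ones_moment a t \<le> n ^ Suc a"
      using ones_moment_le[of a t] power_mono[of "length t" n "Suc a"] by simp
    also have "\<dots> \<le> n ^ (2 * k)"
      using n ak by (intro power_increasing)
    finally have "real (ones_moment a t) \<le> real (n ^ (2 * k))" by (rule of_nat_mono)
    then show ?thesis by (simp add: N_def mult.commute flip: power_mult)
  qed
  have "4 * (N\<^sup>2)\<^sup>2 / (real m * (1 / N\<^sup>2)\<^sup>2) = 4 * N ^ 8 / real m"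
    using N by (simp add: field_simps flip: power_mult power_add)
  also have "\<dots> \<le> 4 * N ^ 8 / N ^ 9"
    using m_ge N by (intro divide_left_mono) (auto intro!: mult_pos_pos m_pos)
  also have "\<dots> = 4 / N"
    using N by (simp add: field_simps flip: power_Suc)
  also have "\<dots> \<le> 4 / real n"
    using N n by (intro divide_left_mono) auto
  finally have err: "4 * (N\<^sup>2)\<^sup>2 / (real m * (1 / N\<^sup>2)\<^sup>2) \<le> 4 / real n" .
  show "\<exists>A. distinguishes A m p (4 / real n) x y"
    using bound gap err m_pos N
    by (intro distinguishes_by_statistic[where g = "\<lambda>t. real (ones_moment a t)"
          and B = "N\<^sup>2" and \<delta> = "1 / N\<^sup>2"]) (auto simp: \<mu>_def)
qed simp

end
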